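(* Let $\bm C\in\mathbb S^d_{++}$, $\bm a_1,\dots,\bm a_n\in\mathbb R^d$, $s\in[n]$, and $\bm b_i:=\bm C^{-1/2}\bm a_i$. The Lagrangian dual of the continuous relaxation $$\log\det\bm C+\max\Big\{\log\det\Big(\bm I_d+\sum_{i\in[n]}x_i\bm b_i\bm b_i^\top\Big):\ \bm x\in[0,1]^n,\ \sum_{i\in[n]}x_i=s\Big\}$$ is $$\hat z_R:=\log\det\bm C+\min_{\bm\Lambda\in\mathbb S^d_{++},\ \nu\in\mathbb R,\ \bm\mu\in\mathbb R^n_+}\Big\{-\log\det\bm\Lambda+\operatorname{tr}\bm\Lambda+s\nu+\sum_{i\in[n]}\mu_i-d\ :\ \bm b_i^\top\bm\Lambda\bm b_i\le\nu+\mu_i,\ i\in[n]\Big\}.$$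
   Context: $[n]=\{1,\dots,n\}$; $\mathbb S^d_{++}$ is the set of symmetric positive-definite $d\times d$ matrices; $\bm C^{1/2}$ is the positive-definite square root. The Lagrangian dual is taken with respect to the following form of the relaxation: maximize $\log\det\bm X$ over $\bm X\in\mathbb S^d_{++}$, $\bm x\in\mathbb R^n$ subject to $\bm I_d+\sum_i x_i\bm b_i\bm b_i^\top\succeq\bm X$ (multiplier $\bm\Lambda\in\mathbb S^d_{++}$), $\sum_i x_i=s$ (multiplier $\nu\in\mathbb R$), $x_i\ge0$ (multipliers $\bm\upsilon\in\mathbb R^n_+$), $x_i\le1$ (multipliers $\bm\mu\in\mathbb R^n_+$). The Lagrangian is $$L(\bm x,\bm X,\bm\Lambda,\nu,\bm\upsilon,\bm\mu)=\log\det\bm X+\operatorname{tr}\bm\Lambda-\operatorname{tr}(\bm X\bm\Lambda)+\sum_{i\in[n]}(\bm b_i^\top\bm\Lambda\bm b_i-\nu+\upsilon_i-\mu_i)x_i+s\nu+\sum_{i\in[n]}\mu_i,$$ and the Lagrangian dual (plus the constant $\log\det\bm C$) is $\inf_{\bm\Lambda,\nu,\bm\upsilon,\bm\mu}\ \sup_{\bm X\in\mathbb S^d_{++},\,\bm x\in\mathbb R^n}L$. *)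

theory Defs
  imports "HOL-Analysis.Analysis"
begin

definition spd :: "(real^'d^'d) set" where
  "spd = {A. transpose A = A \<and> (\<forall>v. v \<noteq> 0 \<longrightarrow> v \<bullet> (A *v v) > 0)}"

definition loewner_le :: "real^'d^'d \<Rightarrow> real^'d^'d \<Rightarrow> bool" where
  "loewner_le A B \<longleftrightarrow> transpose (B - A) = B - A \<and> (\<forall>v. v \<bullet> ((B - A) *v v) \<ge> 0)"

definition pd_sqrt :: "real^'d^'d \<Rightarrow> real^'d^'d" where
  "pd_sqrt A = (THE S. S \<in> spd \<and> S ** S = A)"

definition outer :: "real^'d \<Rightarrow> real^'d \<Rightarrow> real^'d^'d" where
  "outer u v = (\<chi> i j. u $ i * v $ j)"

definition nonneg :: "(real^'n) set" where
  "nonneg = {u. \<forall>i. 0 \<le> u $ i}"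

definition info_matrix :: "('n::finite \<Rightarrow> real^'d) \<Rightarrow> real^'n \<Rightarrow> real^'d^'d" where
  "info_matrix b x = mat 1 + (\<Sum>i\<in>UNIV. x $ i *\<^sub>R outer (b i) (b i))"

definition relax_feasible :: "nat \<Rightarrow> (real^'n) set" where
  "relax_feasible s = {x. (\<forall>i. 0 \<le> x $ i \<and> x $ i \<le> 1) \<and> (\<Sum>i\<in>UNIV. x $ i) = real s}"

definition lifted_feasible ::
  "('n::finite \<Rightarrow> real^'d) \<Rightarrow> nat \<Rightarrow> ((real^'d^'d) \<times> (real^'n)) set" where
  "lifted_feasible b s = {(X, x). X \<in> spd \<and> loewner_le X (info_matrix b x)
     \<and> (\<Sum>i\<in>UNIV. x $ i) = real s \<and> (\<forall>i. 0 \<le> x $ i) \<and> (\<forall>i. x $ i \<le> 1)}"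

definition lagrangian ::
  "('n::finite \<Rightarrow> real^'d) \<Rightarrow> nat \<Rightarrow> real^'n \<Rightarrow> real^'d^'d \<Rightarrow>
   real^'d^'d \<Rightarrow> real \<Rightarrow> real^'n \<Rightarrow> real^'n \<Rightarrow> real" where
  "lagrangian b s x X \<Lambda> \<nu> \<upsilon> \<mu> =
     ln (det X) + trace \<Lambda> - trace (X ** \<Lambda>)
     + (\<Sum>i\<in>UNIV. (b i \<bullet> (\<Lambda> *v b i) - \<nu> + \<upsilon> $ i - \<mu> $ i) * x $ i)
     + real s * \<nu> + (\<Sum>i\<in>UNIV. \<mu> $ i)"

definition lagrangian_dual :: "('n::finite \<Rightarrow> real^'d) \<Rightarrow> nat \<Rightarrow> ereal" where
  "lagrangian_dual b s =
     (INF (\<Lambda>, \<nu>, \<upsilon>, \<mu>) \<in> spd \<times> UNIV \<times> nonneg \<times> nonneg.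
        SUP (X, x) \<in> spd \<times> UNIV. ereal (lagrangian b s x X \<Lambda> \<nu> \<upsilon> \<mu>))"

definition dual_feasible ::
  "('n::finite \<Rightarrow> real^'d) \<Rightarrow> ((real^'d^'d) \<times> real \<times> (real^'n)) set" where
  "dual_feasible b = {(\<Lambda>, \<nu>, \<mu>). \<Lambda> \<in> spd \<and> \<mu> \<in> nonneg
     \<and> (\<forall>i. b i \<bullet> (\<Lambda> *v b i) \<le> \<nu> + \<mu> $ i)}"

definition dual_objective :: "nat \<Rightarrow> (real^'d^'d) \<times> real \<times> (real^'n) \<Rightarrow> real" where
  "dual_objective s = (\<lambda>(\<Lambda>, \<nu>, \<mu>).
     - ln (det \<Lambda>) + trace \<Lambda> + real s * \<nu> + (\<Sum>i\<in>UNIV. \<mu> $ i) - real CARD('d))"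

(* The explicit Lagrangian is objective plus multipliers paired with constraint slacks,
   matrices being paired by the trace inner product. *)
lemma lagrangian_eq_slacks:
  "lagrangian b s x X \<Lambda> \<nu> \<upsilon> \<mu> =
     ln (det X) + trace ((info_matrix b x - X) ** \<Lambda>)
     + \<nu> * (real s - (\<Sum>i\<in>UNIV. x $ i)) + \<upsilon> \<bullet> x + \<mu> \<bullet> (1 - x)"
proof -
  have tr: "trace (outer u u ** \<Lambda>) = u \<bullet> (\<Lambda> *v u)" for u :: "real^'b"
    unfolding trace_def outer_def matrix_matrix_mult_def matrix_vector_mult_def inner_vec_def
    by (simp add: sum_distrib_left mult_ac, subst sum.swap, simp add: mult_ac)
  have lin: "trace ((A + B) ** \<Lambda>) = trace (A ** \<Lambda>) + trace (B ** \<Lambda>)"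
    "trace ((A - B) ** \<Lambda>) = trace (A ** \<Lambda>) - trace (B ** \<Lambda>)"
    "trace ((c *\<^sub>R A) ** \<Lambda>) = c * trace (A ** \<Lambda>)" for A B :: "real^'b^'b" and c
    by (simp_all add: trace_def matrix_matrix_mult_def sum.distrib sum_subtractf
        sum_distrib_left algebra_simps)
  have "trace ((\<Sum>i\<in>I. x $ i *\<^sub>R outer (b i) (b i)) ** \<Lambda>)
      = (\<Sum>i\<in>I. x $ i * (b i \<bullet> (\<Lambda> *v b i)))" if "finite I" for I
    using that
    by (induction I) (simp_all add: lin tr, simp add: trace_def matrix_matrix_mult_def)
  then show ?thesis
    unfolding lagrangian_def info_matrix_def lin
    by (simp add: inner_vec_def sum.distrib sum_subtractf sum_distrib_left algebra_simps)
qed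

lemma spd_congruence_mat_1:
  fixes A :: "real^'d^'d"
  assumes "A \<in> spd"
  obtains R :: "real^'d^'d" where "transpose R ** A ** R = mat 1"
proof -
  have sym: "u \<bullet> (A *v v) = v \<bullet> (A *v u)" for u v
    using assms unfolding spd_def
    by (metis (mono_tags, lifting) dot_lmul_matrix inner_commute mem_Collect_eq vector_transpose_matrix)
  have "\<exists>w :: 'd \<Rightarrow> real^'d. \<forall>i\<in>J. \<forall>j\<in>J. w i \<bullet> (A *v w j) = (if i = j then 1 else 0)" for J :: "'d set"
  proof (induction J rule: finite_induct[OF finite])
    case 1
    show ?case by simp
  next
    case (2 k J)
    then obtain w where w: "\<And>i j. i \<in> J \<Longrightarrow> j \<in> J \<Longrightarrow> w i \<bullet> (A *v w j) = (if i = j then 1 else 0)"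
      by blast
    have "dim (w ` J) \<le> card J"
      by (metis card_image_le dim_le_card dual_order.trans finite finite_imageI span_superset)
    also have "card J < CARD('d)"
      using 2 by (metis UNIV_I finite_class.finite_UNIV psubsetI psubset_card_mono subset_UNIV)
    finally have "span (w ` J) \<noteq> UNIV"
      by (metis DIM_cart DIM_real dim_UNIV dim_span less_irrefl mult.right_neutral)
    then obtain v where v: "v \<notin> span (w ` J)" by blast
    define v' where "v' = v - (\<Sum>j\<in>J. (w j \<bullet> (A *v v)) *\<^sub>R w j)"
    have "(\<Sum>j\<in>J. (w j \<bullet> (A *v v)) *\<^sub>R w j) \<in> span (w ` J)"
      by (intro span_sum span_scale span_base) auto
    with v have "v' \<noteq> 0" unfolding v'_def by auto
    then have q: "v' \<bullet> (A *v v') > 0" using assms by (auto simp: spd_def)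
    have orth: "w i \<bullet> (A *v v') = 0" if "i \<in> J" for i
    proof -
      have "w i \<bullet> (A *v v') = w i \<bullet> (A *v v) - (\<Sum>j\<in>J. (w j \<bullet> (A *v v)) * (w i \<bullet> (A *v w j)))"
        unfolding v'_def
        by (simp add: matrix_vector_mult_diff_distrib vec.sum inner_diff_right inner_sum_right
            matrix_vector_mult_scaleR linear_sum[OF matrix_vector_mul_linear])
      also have "\<dots> = w i \<bullet> (A *v v) - (\<Sum>j\<in>J. if i = j then w j \<bullet> (A *v v) else 0)"
        using w that by (intro arg_cong2[where f="(-)"] sum.cong refl) auto
      also have "\<dots> = 0" using that by simp
      finally show ?thesis .
    qed
    have orth': "v' \<bullet> (A *v w i) = 0" if "i \<in> J" for i
      using orth[OF that] sym by metis
    define w' where "w' = w(k := (1 / sqrt (v' \<bullet> (A *v v'))) *\<^sub>R v')"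
    have "w' i \<bullet> (A *v w' j) = (if i = j then 1 else 0)" if "i \<in> insert k J" "j \<in> insert k J" for i j
      using that 2 w orth orth' q unfolding w'_def
      by (auto simp: matrix_vector_mult_scaleR field_simps)
    then show ?case by blast
  qed
  from this[of UNIV] obtain w :: "'d \<Rightarrow> real^'d"
    where w: "\<And>i j. w i \<bullet> (A *v w j) = (if i = j then 1 else 0)" by auto
  define R :: "real^'d^'d" where "R = (\<chi> i j. w j $ i)"
  have "(transpose R ** (A ** R)) $ i $ j = w i \<bullet> (A *v w j)" for i j
    by (simp add: R_def transpose_def matrix_matrix_mult_def matrix_vector_mult_def inner_vec_def)
  then have "transpose R ** A ** R = mat 1"
    by (simp add: vec_eq_iff mat_def w matrix_mul_assoc[symmetric])
  then show ?thesis using that by blast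
qed

lemma spd_det_pos:
  fixes A :: "real^'d^'d"
  assumes "A \<in> spd"
  shows "det A > 0"
proof -
  obtain R :: "real^'d^'d" where "transpose R ** A ** R = mat 1"
    using spd_congruence_mat_1[OF assms] .
  then have "det R * det A * det R = 1"
    by (metis det_I det_mul det_transpose)
  then have "det A * (det R)\<^sup>2 = 1" by (simp add: power2_eq_square ac_simps)
  then show ?thesis
    by (metis zero_less_mult_pos2 zero_less_one zero_less_power2 mult_zero_right power_zero_numeral zero_neq_one)
qed

lemma contraction_abs_det_le_1:
  fixes T :: "real^'d^'d"
  assumes "\<And>v. norm (T *v v) \<le> norm v"
  shows "\<bar>det T\<bar> \<le> 1"
proof (rule ccontr)
  assume "\<not> ?thesis"
  then obtain k where k: "\<bar>det T\<bar> ^ k > fact CARD('d)"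
    using real_arch_pow[of "\<bar>det T\<bar>" "fact CARD('d)"] by auto
  have "\<exists>P :: real^'d^'d. (\<forall>v. norm (P *v v) \<le> norm v) \<and> det P = det T ^ k" for k
  proof (induction k)
    case 0
    show ?case by (rule exI[of _ "mat 1"]) simp
  next
    case (Suc k)
    then obtain P :: "real^'d^'d" where P: "\<And>v. norm (P *v v) \<le> norm v" "det P = det T ^ k" by blast
    have "norm ((T ** P) *v v) \<le> norm v" for v
      using assms[of "P *v v"] P(1)[of v] by (simp add: matrix_vector_mul_assoc[symmetric])
    then show ?case using P by (intro exI[of _ "T ** P"]) (simp add: det_mul)
  qed
  then obtain P :: "real^'d^'d" where P: "\<And>v. norm (P *v v) \<le> norm v" "det P = det T ^ k" by blast
  have entry: "\<bar>P $ i $ j\<bar> \<le> 1" for i j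
  proof -
    have "P $ i $ j = (P *v axis j 1) $ i"
      by (simp add: matrix_vector_mult_basis column_def)
    also have "\<bar>\<dots>\<bar> \<le> norm (P *v axis j 1)" by (rule component_le_norm_cart)
    also have "\<dots> \<le> norm (axis j 1 :: real^'d)" by (rule P)
    finally show ?thesis by simp
  qed
  have "\<bar>det P\<bar> \<le> (\<Sum>p | p permutes (UNIV::'d set). \<bar>of_int (sign p) * (\<Prod>i\<in>UNIV. P $ i $ p i)\<bar>)"
    unfolding det_def by (rule sum_abs)
  also have "\<dots> \<le> (\<Sum>p | p permutes (UNIV::'d set). 1)"
    by (intro sum_mono) (auto simp: abs_mult abs_prod sign_def intro!: prod_le_1 entry)
  also have "\<dots> = fact CARD('d)" by (simp add: card_permutations)
  finally show False using k P by (simp add: power_abs)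
qed

lemma spd_det_mono:
  fixes X A :: "real^'d^'d"
  assumes X: "X \<in> spd" and A: "A \<in> spd" and le: "loewner_le X A"
  shows "det X \<le> det A"
proof -
  obtain R :: "real^'d^'d" where R: "transpose R ** A ** R = mat 1" using spd_congruence_mat_1[OF A] .
  obtain Q :: "real^'d^'d" where Q: "transpose Q ** X ** Q = mat 1" using spd_congruence_mat_1[OF X] .
  have quad: "(T *v y) \<bullet> (M *v (T *v y)) = y \<bullet> y"
    if "transpose T ** M ** T = mat 1" for T M :: "real^'d^'d" and y
    by (metis (no_types, lifting) dot_lmul_matrix matrix_vector_mul_assoc matrix_vector_mul_lid
        that transpose_matrix_vector transpose_transpose inner_commute)
  obtain Q' where Q': "Q ** Q' = mat 1"
    using Q by (metis invertible_def invertible_left_inverse)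
  define T where "T = Q' ** R"
  have QT: "Q ** T = R" unfolding T_def by (simp add: matrix_mul_assoc Q')
  have "norm (T *v y) \<le> norm y" for y
  proof -
    define x where "x = R *v y"
    have xT: "x = Q *v (T *v y)" unfolding x_def QT[symmetric] by (simp add: matrix_vector_mul_assoc)
    have "(T *v y) \<bullet> (T *v y) = x \<bullet> (X *v x)" using quad[OF Q] xT by simp
    also have "\<dots> \<le> x \<bullet> (A *v x)"
      using le unfolding loewner_le_def
      by (simp add: matrix_vector_mult_diff_rdistrib inner_diff_right)
    also have "\<dots> = y \<bullet> y" using quad[OF R] by (simp add: x_def)
    finally show ?thesis by (simp add: norm_le)
  qed
  then have "\<bar>det T\<bar> \<le> 1" by (rule contraction_abs_det_le_1)
  then have "\<bar>det R\<bar> \<le> \<bar>det Q\<bar>"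
    unfolding QT[symmetric] by (simp add: det_mul abs_mult mult_left_le)
  then have RQ: "(det R)\<^sup>2 \<le> (det Q)\<^sup>2" by (simp add: abs_le_square_iff)
  have "det A * (det R)\<^sup>2 = 1" "det X * (det Q)\<^sup>2 = 1"
    using arg_cong[OF R, of det] arg_cong[OF Q, of det]
    by (simp_all add: det_mul power2_eq_square ac_simps)
  moreover have "det X * (det R)\<^sup>2 \<le> det X * (det Q)\<^sup>2"
    using RQ spd_det_pos[OF X] by simp
  moreover have "(det R)\<^sup>2 > 0" using calculation(1) by (metis mult_zero_right zero_less_power2 power_zero_numeral zero_neq_one)
  ultimately show ?thesis by (metis mult_le_cancel_right_pos)
qed

lemma info_matrix_spd:
  assumes "\<And>i. 0 \<le> x $ i"
  shows "info_matrix b x \<in> spd"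
proof -
  have "transpose (info_matrix b x) = info_matrix b x"
    by (simp add: info_matrix_def outer_def transpose_def mat_def vec_eq_iff ac_simps)
  moreover have "v \<bullet> (info_matrix b x *v v) > 0" if "v \<noteq> 0" for v
  proof -
    have o: "v \<bullet> (outer u u *v v) = (u \<bullet> v)\<^sup>2" for u
      by (simp add: outer_def inner_vec_def matrix_vector_mult_def power2_eq_square
          sum_product sum_distrib_left ac_simps)
    have "v \<bullet> ((\<Sum>i\<in>I. x $ i *\<^sub>R outer (b i) (b i)) *v v) = (\<Sum>i\<in>I. x $ i * (b i \<bullet> v)\<^sup>2)"
      if "finite I" for I
      using that
      by (induction I) (simp_all add: matrix_vector_mult_add_rdistrib inner_add_right o
          scaleR_matrix_vector_assoc[symmetric])
    then have "v \<bullet> (info_matrix b x *v v) = v \<bullet> v + (\<Sum>i\<in>UNIV. x $ i * (b i \<bullet> v)\<^sup>2)"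
      by (simp add: info_matrix_def matrix_vector_mult_add_rdistrib inner_add_right)
    moreover have "(\<Sum>i\<in>UNIV. x $ i * (b i \<bullet> v)\<^sup>2) \<ge> 0"
      using assms by (intro sum_nonneg) simp
    ultimately show ?thesis using that by (simp add: add_pos_nonneg)
  qed
  ultimately show ?thesis by (simp add: spd_def)
qed

(* The form used for dualization has the same optimal value as the continuous relaxation. *)
lemma relaxation_eq_lifted:
  fixes b :: "'n::finite \<Rightarrow> real^'d"
  shows
  "(SUP x\<in>relax_feasible s. ereal (ln (det (info_matrix b x)))) =
   (SUP (X, x)\<in>lifted_feasible b s. ereal (ln (det X)))"
proof (rule antisym; rule SUP_least)
  fix x :: "real^'n" assume x: "x \<in> relax_feasible s"
  then have "info_matrix b x \<in> spd"
    by (intro info_matrix_spd) (auto simp: relax_feasible_def)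
  with x have "(info_matrix b x, x) \<in> lifted_feasible b s"
    by (auto simp: relax_feasible_def lifted_feasible_def loewner_le_def transpose_def vec_eq_iff)
  then show "ereal (ln (det (info_matrix b x))) \<le> (SUP (X, x)\<in>lifted_feasible b s. ereal (ln (det X)))"
    by (intro SUP_upper2) auto
next
  fix p :: "(real^'d^'d) \<times> (real^'n)" assume "p \<in> lifted_feasible b s"
  then obtain X x where p: "p = (X, x)" and X: "X \<in> spd" "loewner_le X (info_matrix b x)"
    and x: "x \<in> relax_feasible s" and nn: "\<And>i. 0 \<le> x $ i"
    by (auto simp: lifted_feasible_def relax_feasible_def)
  have "ln (det X) \<le> ln (det (info_matrix b x))"
    using X spd_det_pos[OF X(1)] spd_det_mono info_matrix_spd[OF nn]
    by (metis ln_mono order_less_le_trans)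
  then show "(case p of (X, x) \<Rightarrow> ereal (ln (det X))) \<le> (SUP x\<in>relax_feasible s. ereal (ln (det (info_matrix b x))))"
    unfolding p using x by (auto intro: SUP_upper2)
qed

end

theory Submission
  imports Defs
begin

text \<open>For fixed multipliers the Lagrangian is affine in \<open>x\<close>, so its supremum is \<open>\<infinity>\<close> unless all
  coefficients of \<open>x\<close> vanish; since \<open>\<upsilon> \<ge> 0\<close> is a slack variable, this is exactly the
  constraint \<open>b\<^sub>i \<bullet> \<Lambda> b\<^sub>i \<le> \<nu> + \<mu>\<^sub>i\<close>. In \<open>X\<close> one maximizes \<open>ln det X - tr (X \<Lambda>)\<close>. Factoring
  \<open>\<Lambda> = Q Q\<^sup>T\<close> and applying \<open>ln det A \<le> tr A - d\<close> (the sum of \<open>ln \<lambda> \<le> \<lambda> - 1\<close> over the eigenvalues of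
  \<open>A\<close>) to \<open>A = Q\<^sup>T X Q\<close> gives the value \<open>- ln det \<Lambda> - d\<close>, attained at \<open>X = \<Lambda>\<^sup>-\<^sup>1\<close>.

  The dual minimum is attained although the sublevel sets may be unbounded: if \<open>\<nu> < 0\<close>, replacing
  \<open>(\<nu>, \<mu>)\<close> by \<open>(0, \<mu> + \<nu>)\<close> does not increase the objective because \<open>s \<le> n\<close>. On the part of a
  sublevel set with \<open>\<nu> \<ge> 0\<close>, \<open>s \<ge> 1\<close> bounds \<open>\<nu>\<close> and \<open>\<mu>\<close>, and \<open>ln det (\<Lambda>/2) \<le> tr (\<Lambda>/2) - d\<close> bounds
  \<open>tr \<Lambda>\<close> above; since \<open>tr \<Lambda> \<ge> 0\<close>, the objective also keeps \<open>det \<Lambda>\<close> away from \<open>0\<close>.\<close>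

section \<open>Eigenvectors of symmetric matrices and the inequality between log-determinant and
  trace\<close>

text \<open>This is the first-order condition behind both variational arguments below: near
  \<open>t = 0\<close> the linear term dominates. The point \<open>t = - c / k\<close> with
  \<open>k > \<bar>e\<bar>\<close> makes a nonzero \<open>c\<close> visible as a negative
  value.\<close>

lemma quadratic_nonneg_imp_linear_zero:
  fixes c e :: real
  assumes "\<And>t. 0 \<le> c * t + e * t\<^sup>2"
  shows "c = 0"
proof (rule ccontr)
  assume "c \<noteq> 0"
  define k where "k = \<bar>e\<bar> + 1"
  have k: "k > 0" "e - k < 0" unfolding k_def by auto
  have "0 \<le> c * (- c / k) + e * (- c / k)\<^sup>2" by (rule assms)
  also have "\<dots> = (c / k)\<^sup>2 * (e - k)"
    using k by (simp add: field_simps power2_eq_square)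
  also have "\<dots> < 0" using k \<open>c \<noteq> 0\<close> by (simp add: mult_pos_neg)
  finally show False by simp
qed

lemma transpose_self_inner:
  fixes A :: "real^'d^'d"
  assumes "transpose A = A"
  shows "u \<bullet> (A *v v) = v \<bullet> (A *v u)"
  using assms by (metis dot_lmul_matrix inner_commute vector_transpose_matrix)

lemma quadratic_form_add_scaleR:
  fixes A :: "real^'d^'d"
  assumes "transpose A = A"
  shows "(u + t *\<^sub>R v) \<bullet> (A *v (u + t *\<^sub>R v))
    = u \<bullet> (A *v u) + 2 * (v \<bullet> (A *v u)) * t + (v \<bullet> (A *v v)) * t\<^sup>2"
  using transpose_self_inner[OF assms, of u v]
  by (simp add: matrix_vector_right_distrib matrix_vector_mult_scaleR inner_add_left inner_add_right
      power2_eq_square algebra_simps)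

text \<open>Each new eigenvector maximizes the Rayleigh quotient on the orthogonal complement of the
  previous ones. Indexing by subsets \<open>J\<close> of the coordinate type lets the induction end
  at \<open>UNIV\<close> with a full eigenbasis.\<close>

lemma symmetric_orthonormal_eigenvectors:
  fixes A :: "real^'d^'d" and J :: "'d set"
  assumes sym: "transpose A = A"
  shows "\<exists>(w :: 'd \<Rightarrow> real^'d) (l :: 'd \<Rightarrow> real). (\<forall>i\<in>J. \<forall>j\<in>J. w i \<bullet> w j = (if i = j then 1 else 0))
    \<and> (\<forall>i\<in>J. A *v w i = l i *\<^sub>R w i)"
proof (induction J rule: finite_induct[OF finite])
  case 1
  show ?case by simp
next
  case (2 k J)
  then obtain w :: "'d \<Rightarrow> real^'d" and l where w: "\<And>i j. i \<in> J \<Longrightarrow> j \<in> J \<Longrightarrow> w i \<bullet> w j = (if i = j then 1 else 0)"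
    and l: "\<And>i. i \<in> J \<Longrightarrow> A *v w i = l i *\<^sub>R w i"
    by blast
  have "dim (w ` J) \<le> card J"
    by (metis card_image_le dim_le_card dual_order.trans finite finite_imageI span_superset)
  also have "card J < CARD('d)"
    using 2 by (metis UNIV_I finite_class.finite_UNIV psubsetI psubset_card_mono subset_UNIV)
  finally have "dim (w ` J) < DIM(real^'d)" by simp
  then obtain x where x: "x \<noteq> 0" "\<And>y. y \<in> span (w ` J) \<Longrightarrow> orthogonal x y"
    using orthogonal_to_subspace_exists by blast
  define S where "S = {v. \<forall>j\<in>J. w j \<bullet> v = 0}"
  define K where "K = S \<inter> sphere 0 1"
  have "S = (\<Inter>j\<in>J. {v. w j \<bullet> v = 0})" by (auto simp: S_def)
  then have "closed S" by (auto intro: closed_hyperplane)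
  then have "compact K" unfolding K_def by (simp add: closed_Int_compact)
  moreover have "x \<in> S"
    unfolding S_def using x(2) by (auto simp: orthogonal_def span_base inner_commute[of _ x])
  then have "(1 / norm x) *\<^sub>R x \<in> K" using x(1) by (simp add: K_def S_def)
  then have "K \<noteq> {}" by blast
  moreover have "continuous_on K (\<lambda>v. v \<bullet> (A *v v))"
    by (intro continuous_intros linear_continuous_on_compose[OF continuous_on_id]
        matrix_vector_mul_linear)
  ultimately obtain u where u: "u \<in> K" "\<And>v. v \<in> K \<Longrightarrow> v \<bullet> (A *v v) \<le> u \<bullet> (A *v u)"
    using continuous_attains_sup[of K] by metis
  define m where "m = u \<bullet> (A *v u)"
  have uS: "u \<in> S" and uu: "u \<bullet> u = 1" using u(1) by (auto simp: K_def norm_eq_1)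
  \<comment> \<open>Homogeneity carries the bound from the unit sphere to all of \<open>S\<close>,
    so the perturbations \<open>u + t *\<^sub>R h\<close> below need no normalization.\<close>
  have max: "v \<bullet> (A *v v) \<le> m * (v \<bullet> v)" if "v \<in> S" for v
  proof (cases "v = 0")
    case False
    then have "(1 / norm v) *\<^sub>R v \<in> K" using that by (simp add: K_def S_def)
    from u(2)[OF this] False show ?thesis
      by (simp add: matrix_vector_mult_scaleR m_def field_simps dot_square_norm power2_eq_square)
  qed simp
  have orth: "h \<bullet> (A *v u) = 0" if h: "h \<in> S" "h \<bullet> u = 0" for h
  proof -
    have "0 \<le> - 2 * (h \<bullet> (A *v u)) * t + (m * (h \<bullet> h) - h \<bullet> (A *v h)) * t\<^sup>2" for t
    proof -
      have "u + t *\<^sub>R h \<in> S" using uS h by (simp add: S_def inner_add_right)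
      from max[OF this] have "(u + t *\<^sub>R h) \<bullet> (A *v (u + t *\<^sub>R h)) \<le> m * (1 + t\<^sup>2 * (h \<bullet> h))"
        using h uu by (simp add: inner_add_left inner_add_right inner_commute power2_eq_square mult.assoc)
      then show ?thesis
        unfolding quadratic_form_add_scaleR[OF sym] m_def[symmetric] by (simp add: algebra_simps)
    qed
    from quadratic_nonneg_imp_linear_zero[OF this] show ?thesis by simp
  qed
  \<comment> \<open>The residual of the eigenvalue equation lies in \<open>S\<close> and is
    orthogonal to \<open>u\<close>, hence is itself an admissible direction \<open>h\<close>. It is
    therefore orthogonal to \<open>A *v u\<close> as well, and so to itself.\<close>
  define g where "g = A *v u - m *\<^sub>R u"
  have "w j \<bullet> (A *v u) = 0" if "j \<in> J" for j
    unfolding transpose_self_inner[OF sym, of "w j"]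
    using uS l[OF that] that by (simp add: S_def inner_commute[of u])
  then have "g \<in> S"
    using uS by (simp add: S_def g_def inner_diff_right)
  moreover have gu: "g \<bullet> u = 0"
    using uu by (simp add: g_def inner_diff_left m_def inner_commute[of "A *v u"])
  ultimately have "g \<bullet> (A *v u) = 0" by (rule orth)
  then have "g \<bullet> (A *v u - m *\<^sub>R u) = 0" using gu by (simp add: inner_diff_right)
  then have "g \<bullet> g = 0" by (simp only: g_def)
  then have Au: "A *v u = m *\<^sub>R u" by (simp add: g_def)
  have "(w(k := u)) i \<bullet> (w(k := u)) j = (if i = j then 1 else 0)"
    if "i \<in> insert k J" "j \<in> insert k J" for i j
    using that w uS uu 2 by (auto simp: S_def inner_commute[of u "w _"])
  moreover have "A *v (w(k := u)) i = (l(k := m)) i *\<^sub>R (w(k := u)) i" if "i \<in> insert k J" for i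
    using that l Au by auto
  ultimately show ?case by blast
qed

lemma spd_ln_det_le_trace:
  fixes A :: "real^'d^'d"
  assumes A: "A \<in> spd"
  shows "ln (det A) \<le> trace A - real CARD('d)"
proof -
  have sym: "transpose A = A" using A by (simp add: spd_def)
  obtain w :: "'d \<Rightarrow> real^'d" and l where w: "\<And>i j. w i \<bullet> w j = (if i = j then 1 else 0)"
    and l: "\<And>i. A *v w i = l i *\<^sub>R w i"
    using symmetric_orthonormal_eigenvectors[OF sym, of UNIV] by auto
  define W :: "real^'d^'d" where "W = (\<chi> i j. w j $ i)"
  have quad: "(transpose W ** (M ** W)) $ i $ j = w i \<bullet> (M *v w j)" for M i j
    by (simp add: W_def transpose_def matrix_matrix_mult_def matrix_vector_mult_def inner_vec_def)
  have WW: "transpose W ** W = mat 1"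
    using quad[of "mat 1"] by (simp add: vec_eq_iff w) (simp add: mat_def)
  then have WW': "W ** transpose W = mat 1" by (simp add: matrix_left_right_inverse)
  \<comment> \<open>Since \<open>W\<close> is orthogonal, \<open>D\<close> has the trace and
    determinant of \<open>A\<close>, and it is diagonal with the eigenvalues as entries.\<close>
  define D where "D = transpose W ** (A ** W)"
  have D: "D $ i $ j = (if i = j then l i else 0)" for i j
    by (simp add: D_def quad l w)
  have "det D = det A"
    using arg_cong[OF WW, of det] by (simp add: D_def det_mul)
  moreover have "det D = (\<Prod>i\<in>UNIV. l i)"
    by (subst det_diagonal) (simp_all add: D)
  moreover have "trace D = trace A"
    unfolding D_def trace_mul_sym[of "transpose W"] by (simp add: matrix_mul_assoc[symmetric] WW')
  moreover have "trace D = (\<Sum>i\<in>UNIV. l i)"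
    by (simp add: trace_def D)
  moreover have pos: "l i > 0" for i
  proof -
    have "w i \<noteq> 0" using w[of i i] by auto
    then have "w i \<bullet> (A *v w i) > 0" using A by (simp add: spd_def)
    then show ?thesis by (simp add: l w)
  qed
  moreover have "ln (\<Prod>i\<in>UNIV. l i) = (\<Sum>i\<in>UNIV. ln (l i))"
    using pos by (intro ln_prod) (auto simp: less_imp_neq[symmetric])
  moreover have "(\<Sum>i\<in>UNIV. ln (l i)) \<le> (\<Sum>i\<in>UNIV. l i - 1)"
    using pos by (intro sum_mono) (simp add: ln_le_minus_one)
  ultimately show ?thesis by (simp add: sum_subtractf)
qed

section \<open>Congruences and maximization of the Lagrangian over the matrix variable\<close>

lemma spd_congruence:
  fixes X R :: "real^'d^'d"
  assumes X: "X \<in> spd" and R: "det R \<noteq> 0"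
  shows "transpose R ** X ** R \<in> spd"
proof -
  have "R *v v \<noteq> 0" if "v \<noteq> 0" for v
    using that R by (metis invertible_det_nz invertible_left_inverse matrix_left_invertible_ker)
  moreover have "v \<bullet> ((transpose R ** X ** R) *v v) = (R *v v) \<bullet> (X *v (R *v v))" for v
    by (simp add: matrix_vector_mul_assoc[symmetric])
       (metis dot_lmul_matrix inner_commute transpose_matrix_vector)
  ultimately show ?thesis using X
    by (simp add: spd_def matrix_transpose_mul matrix_mul_assoc)
qed

text \<open>Undoing the congruence of \<open>A\<close> to the identity with \<open>P\<close>, the
  inverse of \<open>R\<close>, gives \<open>A = transpose P ** P\<close>.\<close>

lemma spd_factorization:
  fixes A :: "real^'d^'d"
  assumes A: "A \<in> spd"
  obtains Q :: "real^'d^'d" where "det Q \<noteq> 0" "A = Q ** transpose Q"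
proof -
  obtain R :: "real^'d^'d" where R: "transpose R ** A ** R = mat 1"
    using spd_congruence_mat_1[OF A] .
  then obtain P where P: "P ** R = mat 1"
    by (metis matrix_left_right_inverse)
  then have "R ** P = mat 1" by (simp add: matrix_left_right_inverse)
  moreover from this have "transpose P ** transpose R = mat 1"
    by (metis matrix_transpose_mul transpose_mat)
  ultimately have "A = transpose P ** (transpose R ** A ** R) ** P"
    by (metis matrix_mul_assoc matrix_mul_lid matrix_mul_rid)
  then have "A = transpose P ** transpose (transpose P)" using R by simp
  moreover have "det P \<noteq> 0" using arg_cong[OF P, of det] by (auto simp: det_mul)
  ultimately show ?thesis using that[of "transpose P"] by simp
qed

lemma spd_inverse_exists:
  fixes A :: "real^'d^'d"
  assumes A: "A \<in> spd"
  obtains B :: "real^'d^'d" where "B \<in> spd" "B ** A = mat 1"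
proof -
  obtain R :: "real^'d^'d" where "transpose R ** A ** R = mat 1"
    using spd_congruence_mat_1[OF A] .
  then have "R ** (transpose R ** A) = mat 1" and dR: "det R \<noteq> 0"
    using arg_cong[of "transpose R ** A ** R" "mat 1" det]
    by (auto simp: matrix_left_right_inverse det_mul)
  then have "(R ** transpose R) ** A = mat 1" by (simp add: matrix_mul_assoc)
  moreover have "mat 1 \<in> (spd :: (real^'d^'d) set)" by (simp add: spd_def)
  from spd_congruence[OF this, of "transpose R"] dR have "R ** transpose R \<in> spd" by simp
  ultimately show ?thesis using that by blast
qed

text \<open>The congruence \<open>A\<close> stands in for \<open>X ** L\<close>, which need not be
  symmetric; both have the same trace and determinant.\<close>

lemma ln_det_diff_trace_le:
  fixes X L :: "real^'d^'d"
  assumes X: "X \<in> spd" and L: "L \<in> spd"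
  shows "ln (det X) - trace (X ** L) \<le> - ln (det L) - real CARD('d)"
proof -
  obtain Q where Q: "det Q \<noteq> 0" "L = Q ** transpose Q"
    using spd_factorization[OF L] .
  define A where "A = transpose Q ** X ** Q"
  have "A \<in> spd" unfolding A_def using X Q(1) by (rule spd_congruence)
  then have "ln (det A) \<le> trace A - real CARD('d)" by (rule spd_ln_det_le_trace)
  moreover have "trace A = trace (X ** L)"
    unfolding A_def Q(2) by (metis matrix_mul_assoc trace_mul_sym)
  moreover have "det A = det X * det L" by (simp add: A_def Q(2) det_mul)
  then have "ln (det A) = ln (det X) + ln (det L)"
    using spd_det_pos[OF X] spd_det_pos[OF L] by (simp add: ln_mult)
  ultimately show ?thesis by simp
qed

section \<open>The value of the Lagrangian dual\<close>

text \<open>This choice of \<open>\<upsilon>\<close> cancels every coefficient of \<open>x\<close>,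
  so only the bound on the matrix part remains.\<close>

lemma lagrangian_le_dual_objective:
  fixes b :: "'n::finite \<Rightarrow> real^'d"
  assumes "\<Lambda> \<in> spd" and "X \<in> spd"
    and "\<And>i. \<upsilon> $ i = \<nu> + \<mu> $ i - b i \<bullet> (\<Lambda> *v b i)"
  shows "lagrangian b s x X \<Lambda> \<nu> \<upsilon> \<mu> \<le> dual_objective s (\<Lambda>, \<nu>, \<mu>)"
  using ln_det_diff_trace_le[of X \<Lambda>] assms
  by (simp add: lagrangian_def dual_objective_def)

text \<open>For a lower bound on the dual it is enough that the Lagrangian reaches \<open>m\<close>
  at some point; the inner supremum need not be evaluated. The inverse of \<Lambda> serves as
  \<open>X\<close> in both cases, and only \<open>x\<close> depends on whether its coefficients
  vanish.\<close>

lemma lagrangian_reaches_dual_value: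
  fixes b :: "'n::finite \<Rightarrow> real^'d"
  assumes L: "\<Lambda> \<in> spd" and nn: "\<upsilon> \<in> nonneg" "\<mu> \<in> nonneg"
    and m: "\<And>p. p \<in> dual_feasible b \<Longrightarrow> m \<le> dual_objective s p"
  shows "\<exists>X\<in>spd. \<exists>x. m \<le> lagrangian b s x X \<Lambda> \<nu> \<upsilon> \<mu>"
proof -
  obtain X where X: "X \<in> spd" "X ** \<Lambda> = mat 1"
    using spd_inverse_exists[OF L] .
  define c where "c i = b i \<bullet> (\<Lambda> *v b i) - \<nu> + \<upsilon> $ i - \<mu> $ i" for i
  have val: "lagrangian b s x X \<Lambda> \<nu> \<upsilon> \<mu>
    = dual_objective s (\<Lambda>, \<nu>, \<mu>) + (\<Sum>i\<in>UNIV. c i * x $ i)" for x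
  proof -
    have "det X * det \<Lambda> = 1" by (metis X(2) det_I det_mul)
    then have "ln (det X * det \<Lambda>) = 0" by simp
    then have "ln (det X) = - ln (det \<Lambda>)"
      using spd_det_pos[OF L] spd_det_pos[OF X(1)] by (simp add: ln_mult)
    then show ?thesis
      by (simp add: lagrangian_def dual_objective_def c_def X(2) trace_I)
  qed
  show ?thesis
  proof (cases "\<exists>i. c i \<noteq> 0")
    case True
    then obtain i where i: "c i \<noteq> 0" by blast
    \<comment> \<open>Moving by \<open>t\<close> along coordinate \<open>i\<close> changes the
      Lagrangian by exactly the gap to \<open>m\<close>, whatever the sign of
      \<open>c i\<close>.\<close>
    define t where "t = (m - dual_objective s (\<Lambda>, \<nu>, \<mu>)) / c i"
    have "(\<Sum>j\<in>UNIV. c j * (t *\<^sub>R axis i 1) $ j) = (\<Sum>j\<in>UNIV. if j = i then c i * t else 0)"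
      by (intro sum.cong) (auto simp: axis_def)
    then have "m \<le> lagrangian b s (t *\<^sub>R axis i 1) X \<Lambda> \<nu> \<upsilon> \<mu>"
      unfolding val using i by (simp add: t_def)
    then show ?thesis using X(1) by blast
  next
    case False
    then have "b i \<bullet> (\<Lambda> *v b i) = \<nu> + \<mu> $ i - \<upsilon> $ i" for i
      by (simp add: c_def algebra_simps)
    then have "(\<Lambda>, \<nu>, \<mu>) \<in> dual_feasible b"
      using L nn by (simp add: dual_feasible_def nonneg_def)
    then have "m \<le> lagrangian b s 0 X \<Lambda> \<nu> \<upsilon> \<mu>"
      unfolding val using m by simp
    then show ?thesis using X(1) by blast
  qed
qed

lemma lagrangian_dual_eq_min:
  fixes b :: "'n::finite \<Rightarrow> real^'d"
  assumes p: "p \<in> dual_feasible b"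
    and min: "\<And>q. q \<in> dual_feasible b \<Longrightarrow> dual_objective s p \<le> dual_objective s q"
  shows "lagrangian_dual b s = ereal (dual_objective s p)"
proof (rule antisym)
  obtain \<Lambda> \<nu> \<mu> where p_eq: "p = (\<Lambda>, \<nu>, \<mu>)" by (cases p)
  define \<upsilon> where "\<upsilon> = (\<chi> i. \<nu> + \<mu> $ i - b i \<bullet> (\<Lambda> *v b i))"
  have "(\<Lambda>, \<nu>, \<upsilon>, \<mu>) \<in> spd \<times> UNIV \<times> nonneg \<times> nonneg"
    using p by (auto simp: p_eq dual_feasible_def \<upsilon>_def nonneg_def)
  then have "lagrangian_dual b s \<le> (SUP (X, x) \<in> spd \<times> UNIV. ereal (lagrangian b s x X \<Lambda> \<nu> \<upsilon> \<mu>))"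
    unfolding lagrangian_dual_def by (rule INF_lower2) simp
  also have "\<dots> \<le> ereal (dual_objective s p)"
    using p unfolding p_eq
    by (intro SUP_least)
       (auto simp: dual_feasible_def \<upsilon>_def intro!: lagrangian_le_dual_objective)
  finally show "lagrangian_dual b s \<le> ereal (dual_objective s p)" .
next
  show "ereal (dual_objective s p) \<le> lagrangian_dual b s"
    unfolding lagrangian_dual_def
  proof (rule INF_greatest, clarify)
    fix \<Lambda> :: "real^'d^'d" and \<nu> and \<upsilon> \<mu> :: "real^'n"
    assume "\<Lambda> \<in> spd" "\<upsilon> \<in> nonneg" "\<mu> \<in> nonneg"
    then obtain X x where "X \<in> spd" "dual_objective s p \<le> lagrangian b s x X \<Lambda> \<nu> \<upsilon> \<mu>"
      using lagrangian_reaches_dual_value[of \<Lambda> \<upsilon> \<mu> b "dual_objective s p" s] min by blast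
    then show "ereal (dual_objective s p)
        \<le> (SUP (X, x)\<in>spd \<times> UNIV. ereal (lagrangian b s x X \<Lambda> \<nu> \<upsilon> \<mu>))"
      by (intro SUP_upper2[of "(X, x)"]) auto
  qed
qed

section \<open>Attainment of the dual minimum by compactness\<close>

text \<open>A zero \<open>v\<close> of a nonnegative quadratic form is a minimum of it, so the
  first-order condition forces \<open>A *v v = 0\<close>, and invertibility gives
  \<open>v = 0\<close>.\<close>

lemma psd_det_nonzero_imp_spd:
  fixes A :: "real^'d^'d"
  assumes sym: "transpose A = A" and psd: "\<And>v. 0 \<le> v \<bullet> (A *v v)" and det: "det A \<noteq> 0"
  shows "A \<in> spd"
proof -
  have "v = 0" if "v \<bullet> (A *v v) = 0" for v
  proof -
    have "w \<bullet> (A *v v) = 0" for w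
    proof -
      have "0 \<le> 2 * (w \<bullet> (A *v v)) * t + (w \<bullet> (A *v w)) * t\<^sup>2" for t
        using psd[of "v + t *\<^sub>R w"] that by (simp add: quadratic_form_add_scaleR[OF sym])
      from quadratic_nonneg_imp_linear_zero[OF this] show ?thesis by simp
    qed
    then have "A *v v = 0" by (metis inner_eq_zero_iff)
    then show ?thesis
      using det by (metis invertible_det_nz invertible_left_inverse matrix_left_invertible_ker)
  qed
  then show ?thesis using sym psd by (force simp: spd_def order_less_le)
qed

text \<open>Evaluating the form at the sum and the difference of two basis vectors bounds twice the
  entry by two diagonal entries, each at most the trace.\<close>

lemma psd_entry_le_trace:
  fixes A :: "real^'d^'d"
  assumes sym: "transpose A = A" and psd: "\<And>v. 0 \<le> v \<bullet> (A *v v)"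
  shows "\<bar>A $ i $ j\<bar> \<le> trace A"
proof -
  have e: "axis k 1 \<bullet> (A *v axis l 1) = A $ k $ l" for k l
    by (simp add: inner_axis' matrix_vector_mult_basis column_def)
  have nn: "0 \<le> A $ k $ k" for k using psd[of "axis k 1"] by (simp add: e)
  have le: "A $ k $ k \<le> trace A" for k
    unfolding trace_def using nn by (intro member_le_sum) auto
  have ji: "A $ j $ i = A $ i $ j" using sym by (metis transpose_def vec_lambda_beta)
  have "0 \<le> A $ i $ i + 2 * A $ i $ j * t + A $ j $ j * t\<^sup>2" for t
    using psd[of "axis i 1 + t *\<^sub>R axis j 1"] ji
    unfolding quadratic_form_add_scaleR[OF sym] e by simp
  from this[of 1] this[of "-1"] le[of i] le[of j] show ?thesis by simp
qed

text \<open>Applying the log-determinant inequality to \<open>A / 2\<close> rather than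
  \<open>A\<close> leaves half of the trace over, so \<open>trace A - ln (det A)\<close> controls
  the trace.\<close>

lemma spd_trace_le:
  fixes A :: "real^'d^'d"
  assumes A: "A \<in> spd"
  shows "trace A \<le> 2 * (trace A - ln (det A) + real CARD('d) * ln 2)"
proof -
  define H where "H = (1/2) *\<^sub>R A"
  have "H \<in> spd"
    using A by (auto simp: H_def spd_def transpose_scalar scaleR_matrix_vector_assoc[symmetric])
  then have "ln (det H) \<le> trace H - real CARD('d)" by (rule spd_ln_det_le_trace)
  moreover have "det H = (1/2) ^ CARD('d) * det A"
    using det_rows_mul[of "\<lambda>_. 1/2" "\<lambda>i. A $ i"]
    by (simp add: H_def scaleR_vec_def scalar_mult_eq_scaleR vec_lambda_eta)
  then have "ln (det H) = ln (det A) - real CARD('d) * ln 2"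
    using spd_det_pos[OF A] by (simp add: ln_mult ln_realpow ln_div)
  moreover have "trace H = trace A / 2"
    by (simp add: H_def trace_def sum_divide_distrib)
  ultimately show ?thesis by simp
qed

lemma dual_feasible_nonneg_multiplier:
  fixes b :: "'n::finite \<Rightarrow> real^'d"
  assumes q: "(\<Lambda>, \<nu>, \<mu>) \<in> dual_feasible b" and s: "s \<le> CARD('n)"
  obtains \<nu>' \<mu>' where "(\<Lambda>, \<nu>', \<mu>') \<in> dual_feasible b" "0 \<le> \<nu>'"
    "dual_objective s (\<Lambda>, \<nu>', \<mu>') \<le> dual_objective s (\<Lambda>, \<nu>, \<mu>)"
proof (cases "0 \<le> \<nu>")
  case True
  then show ?thesis using q that by blast
next
  case False
  define \<mu>' where "\<mu>' = (\<chi> i. \<mu> $ i + \<nu>)"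
  \<comment> \<open>With \<open>\<nu>\<close> replaced by zero, the old constraint bounds this
    quantity by the new multiplier, whose sign condition thus follows.\<close>
  have "0 \<le> b i \<bullet> (\<Lambda> *v b i)" for i
    using q by (cases "b i = 0") (auto simp: dual_feasible_def spd_def order_less_le)
  moreover have "b i \<bullet> (\<Lambda> *v b i) \<le> \<mu>' $ i" for i
    using q by (simp add: dual_feasible_def \<mu>'_def add.commute)
  ultimately have "(\<Lambda>, 0, \<mu>') \<in> dual_feasible b"
    using q by (auto simp: dual_feasible_def nonneg_def intro: order_trans)
  moreover have "real CARD('n) * \<nu> \<le> real s * \<nu>"
    using s False by (intro mult_right_mono_neg) auto
  then have "dual_objective s (\<Lambda>, 0, \<mu>') \<le> dual_objective s (\<Lambda>, \<nu>, \<mu>)"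
    by (simp add: dual_objective_def \<mu>'_def sum.distrib)
  ultimately show ?thesis using that by blast
qed

lemma continuous_on_det [continuous_intros]:
  fixes f :: "'a::topological_space \<Rightarrow> real^'d^'d"
  assumes "continuous_on S f"
  shows "continuous_on S (\<lambda>x. det (f x))"
  unfolding det_def by (intro continuous_intros assms)

lemma continuous_on_trace [continuous_intros]:
  fixes f :: "'a::topological_space \<Rightarrow> real^'d^'d"
  assumes "continuous_on S f"
  shows "continuous_on S (\<lambda>x. trace (f x))"
  unfolding trace_def by (intro continuous_intros assms)

lemma continuous_on_quadratic_form [continuous_intros]:
  fixes f :: "'a::topological_space \<Rightarrow> real^'d^'d"
  assumes "continuous_on S f"
  shows "continuous_on S (\<lambda>x. v \<bullet> (f x *v v))"
  unfolding inner_vec_def matrix_vector_mult_def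
  by (simp, intro continuous_intros assms)

text \<open>Positive definiteness is not a closed condition. Semidefiniteness with a lower bound on
  the determinant is, and it implies definiteness once \<open>\<delta> > 0\<close>.\<close>

lemma compact_bounded_multipliers:
  fixes b :: "'n::finite \<Rightarrow> real^'d"
  shows "compact {(\<Lambda> :: real^'d^'d, \<nu>::real, \<mu> :: real^'n).
    transpose \<Lambda> = \<Lambda> \<and> (\<forall>v. 0 \<le> v \<bullet> (\<Lambda> *v v)) \<and> \<delta> \<le> det \<Lambda> \<and> trace \<Lambda> \<le> M
    \<and> 0 \<le> \<nu> \<and> \<nu> \<le> M \<and> (\<forall>i. 0 \<le> \<mu> $ i) \<and> (\<forall>i. \<mu> $ i \<le> M)
    \<and> (\<forall>i. b i \<bullet> (\<Lambda> *v b i) \<le> \<nu> + \<mu> $ i)}" (is "compact ?K")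
proof -
  have K: "?K = {p. (\<forall>i j. fst p $ j $ i = fst p $ i $ j) \<and> (\<forall>v. 0 \<le> v \<bullet> (fst p *v v))
      \<and> \<delta> \<le> det (fst p) \<and> trace (fst p) \<le> M
      \<and> 0 \<le> fst (snd p) \<and> fst (snd p) \<le> M \<and> (\<forall>i. 0 \<le> snd (snd p) $ i) \<and> (\<forall>i. snd (snd p) $ i \<le> M)
      \<and> (\<forall>i. b i \<bullet> (fst p *v b i) \<le> fst (snd p) + snd (snd p) $ i)}"
    by (auto simp: transpose_def vec_eq_iff)
  have "closed ?K"
    unfolding K
    by (intro closed_Collect_conj closed_Collect_all closed_Collect_le closed_Collect_eq continuous_intros)
  moreover have "bounded ?K"
  proof (rule bounded_subset)
    let ?B = "{A :: real^'d^'d. \<forall>i j. \<bar>A $ i $ j\<bar> \<le> M}"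
    let ?C = "{x :: real^'n. \<forall>i. \<bar>x $ i\<bar> \<le> M}"
    have "norm A \<le> (\<Sum>i\<in>(UNIV::'d set). \<Sum>j\<in>(UNIV::'d set). M)" if "A \<in> ?B" for A
    proof -
      have "norm A \<le> (\<Sum>i\<in>UNIV. norm (A $ i))"
        unfolding norm_vec_def[of A] by (rule L2_set_le_sum) simp
      also have "\<dots> \<le> (\<Sum>i\<in>UNIV. \<Sum>j\<in>UNIV. \<bar>A $ i $ j\<bar>)"
        by (intro sum_mono norm_le_l1_cart)
      also have "\<dots> \<le> (\<Sum>i\<in>(UNIV::'d set). \<Sum>j\<in>(UNIV::'d set). M)"
        using that by (intro sum_mono) auto
      finally show ?thesis .
    qed
    then have "bounded ?B" by (intro boundedI) auto
    moreover have "norm x \<le> (\<Sum>i\<in>(UNIV::'n set). M)" if "x \<in> ?C" for x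
      using that by (intro order_trans[OF norm_le_l1_cart] sum_mono) auto
    then have "bounded ?C" by (intro boundedI) auto
    ultimately show "bounded (?B \<times> {0..M} \<times> ?C)"
      by (intro bounded_Times) auto
    have "(A, \<nu>, \<mu>) \<in> ?B \<times> {0..M} \<times> ?C" if K: "(A, \<nu>, \<mu>) \<in> ?K" for A \<nu> \<mu>
    proof -
      have "\<bar>A $ i $ j\<bar> \<le> M" for i j
        using psd_entry_le_trace[of A i j] K by fastforce
      with K show ?thesis by auto
    qed
    then show "?K \<subseteq> ?B \<times> {0..M} \<times> ?C" by auto
  qed
  ultimately show ?thesis by (simp add: compact_eq_bounded_closed)
qed

lemma dual_minimizer_exists:
  fixes b :: "'n::finite \<Rightarrow> real^'d"
  assumes s: "1 \<le> s" "s \<le> CARD('n)"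
  obtains p where "p \<in> dual_feasible b"
    "\<And>q. q \<in> dual_feasible b \<Longrightarrow> dual_objective s p \<le> dual_objective s q"
proof -
  \<comment> \<open>This value of \<nu> makes the identity matrix feasible with zero
    \<open>\<mu>\<close>; the resulting point \<open>p0\<close> fixes the sublevel
    \<open>c\<close>.\<close>
  define \<nu>0 where "\<nu>0 = (\<Sum>i\<in>UNIV. b i \<bullet> b i)"
  define p0 :: "(real^'d^'d) \<times> real \<times> (real^'n)" where "p0 = (mat 1, \<nu>0, 0)"
  have "b i \<bullet> b i \<le> \<nu>0" for i unfolding \<nu>0_def by (intro member_le_sum) auto
  moreover have "0 \<le> \<nu>0" unfolding \<nu>0_def by (intro sum_nonneg) simp
  ultimately have p0: "p0 \<in> dual_feasible b" "0 \<le> fst (snd p0)"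
    by (auto simp: p0_def dual_feasible_def spd_def nonneg_def)
  define c where "c = dual_objective s p0"
  define d where "d = real CARD('d)"
  \<comment> \<open>On the sublevel set with \<open>\<nu> \<ge> 0\<close>,
    \<open>trace \<Lambda> - ln (det \<Lambda>)\<close> is at most \<open>c + d\<close>, so
    \<open>spd_trace_le\<close> bounds the trace by \<open>M\<close>. It is also at least
    \<open>d\<close>, which leaves at most \<open>c\<close> for \<nu> and for each entry of
    \<open>\<mu>\<close>.\<close>
  define M where "M = 2 * \<bar>c\<bar> + 2 * d + 2 * d * ln 2"
  define K where "K = {(\<Lambda> :: real^'d^'d, \<nu>::real, \<mu> :: real^'n).
    transpose \<Lambda> = \<Lambda> \<and> (\<forall>v. 0 \<le> v \<bullet> (\<Lambda> *v v)) \<and> exp (- c - d) \<le> det \<Lambda> \<and> trace \<Lambda> \<le> M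
    \<and> 0 \<le> \<nu> \<and> \<nu> \<le> M \<and> (\<forall>i. 0 \<le> \<mu> $ i) \<and> (\<forall>i. \<mu> $ i \<le> M)
    \<and> (\<forall>i. b i \<bullet> (\<Lambda> *v b i) \<le> \<nu> + \<mu> $ i)}"
  have "compact K" unfolding K_def by (rule compact_bounded_multipliers)
  have det_pos: "0 < det (fst p)" if "p \<in> K" for p
    using that by (auto simp: K_def intro: less_le_trans[OF exp_gt_zero])
  have K_feasible: "p \<in> dual_feasible b" if "p \<in> K" for p
    using that det_pos[OF that]
    by (auto simp: K_def dual_feasible_def nonneg_def intro!: psd_det_nonzero_imp_spd)
  have in_K: "(\<Lambda>, \<nu>, \<mu>) \<in> K"
    if q: "(\<Lambda>, \<nu>, \<mu>) \<in> dual_feasible b" "0 \<le> \<nu>" "dual_objective s (\<Lambda>, \<nu>, \<mu>) \<le> c" for \<Lambda> \<nu> \<mu>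
  proof -
    have L: "\<Lambda> \<in> spd" and nn: "\<And>i. 0 \<le> \<mu> $ i" and le: "\<And>i. b i \<bullet> (\<Lambda> *v b i) \<le> \<nu> + \<mu> $ i"
      using q(1) by (auto simp: dual_feasible_def nonneg_def)
    have psd: "0 \<le> v \<bullet> (\<Lambda> *v v)" for v
      using L by (cases "v = 0") (auto simp: spd_def order_less_le)
    have obj: "trace \<Lambda> - ln (det \<Lambda>) + real s * \<nu> + (\<Sum>i\<in>UNIV. \<mu> $ i) \<le> c + d"
      using q(3) by (simp add: dual_objective_def d_def)
    have tr: "ln (det \<Lambda>) \<le> trace \<Lambda> - d" "trace \<Lambda> \<le> 2 * (trace \<Lambda> - ln (det \<Lambda>) + d * ln 2)"
      unfolding d_def using L by (rule spd_ln_det_le_trace, rule spd_trace_le)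
    have d: "0 \<le> d" "0 \<le> d * ln 2" by (simp_all add: d_def)
    have \<nu>s: "\<nu> \<le> real s * \<nu>" using s(1) q(2) by (simp add: mult_le_cancel_right1)
    have sum0: "0 \<le> (\<Sum>i\<in>UNIV. \<mu> $ i)" using nn by (intro sum_nonneg) simp
    have \<mu>s: "\<mu> $ i \<le> (\<Sum>i\<in>UNIV. \<mu> $ i)" for i using nn by (intro member_le_sum) auto
    \<comment> \<open>Any pair of indices will do: the trace dominates the absolute value of an
      entry.\<close>
    have "0 \<le> trace \<Lambda>"
      using psd_entry_le_trace[of \<Lambda> undefined undefined] L psd by (auto simp: spd_def)
    then have "- c - d \<le> ln (det \<Lambda>)" using obj \<nu>s sum0 q(2) by linarith
    then have "exp (- c - d) \<le> det \<Lambda>"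
      using spd_det_pos[OF L] by (simp add: ln_ge_iff)
    moreover have "trace \<Lambda> \<le> M" "\<nu> \<le> M"
      using obj tr \<nu>s sum0 q(2) d unfolding M_def by argo+
    moreover have "\<mu> $ i \<le> M" for i
      using obj tr \<nu>s \<mu>s[of i] q(2) d unfolding M_def by argo
    ultimately show ?thesis
      using L psd nn le q(2) by (simp add: K_def spd_def)
  qed
  have "p0 \<in> K"
    using p0 in_K[of "fst p0" "fst (snd p0)" "snd (snd p0)"] by (simp add: c_def)
  moreover have "continuous_on K (dual_objective s)"
  proof -
    have "continuous_on K (\<lambda>p. - ln (det (fst p)) + trace (fst p) + real s * fst (snd p)
        + (\<Sum>i\<in>UNIV. snd (snd p) $ i) - real CARD('d))"
      using det_pos by (intro continuous_intros) force
    then show ?thesis by (simp add: dual_objective_def case_prod_unfold)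
  qed
  ultimately obtain p where p: "p \<in> K" "\<And>q. q \<in> K \<Longrightarrow> dual_objective s p \<le> dual_objective s q"
    using continuous_attains_inf[OF \<open>compact K\<close>, of "dual_objective s"] by blast
  have "dual_objective s p \<le> dual_objective s q" if "q \<in> dual_feasible b" for q
  proof -
    obtain \<Lambda> \<nu> \<mu> where q_eq: "q = (\<Lambda>, \<nu>, \<mu>)" by (cases q)
    then obtain \<nu>' \<mu>' where q': "(\<Lambda>, \<nu>', \<mu>') \<in> dual_feasible b" "0 \<le> \<nu>'"
      "dual_objective s (\<Lambda>, \<nu>', \<mu>') \<le> dual_objective s q"
      using dual_feasible_nonneg_multiplier \<open>q \<in> dual_feasible b\<close> s(2) by metis
    show ?thesis
    proof (cases "dual_objective s (\<Lambda>, \<nu>', \<mu>') \<le> c")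
      case True
      then show ?thesis using p(2)[OF in_K[OF q'(1,2)]] q'(3) by linarith
    next
      \<comment> \<open>Outside the sublevel set the objective exceeds its value at
        \<open>p0\<close>, which belongs to \<open>K\<close>.\<close>
      case False
      then show ?thesis using p(2)[OF \<open>p0 \<in> K\<close>] q'(3) by (simp add: c_def)
    qed
  qed
  with K_feasible[OF p(1)] show ?thesis using that by blast
qed

theorem proposition5:
  fixes C :: "real^'d^'d" and a b :: "'n::finite \<Rightarrow> real^'d" and s :: nat
  assumes "C \<in> spd"
    and "s \<in> {1..CARD('n)}"
    and "\<And>i. b i = matrix_inv (pd_sqrt C) *v a i"
  shows "(\<exists>p. is_arg_min (dual_objective s) (\<lambda>p. p \<in> dual_feasible b) p)
    \<and> ereal (ln (det C)) + lagrangian_dual b s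
        = ereal (ln (det C) + (INF p\<in>dual_feasible b. dual_objective s p))"
proof -
  obtain p where p: "p \<in> dual_feasible b"
    and min: "\<And>q. q \<in> dual_feasible b \<Longrightarrow> dual_objective s p \<le> dual_objective s q"
    using assms(2) by (auto intro: dual_minimizer_exists[of s b])
  \<comment> \<open>Attainment ensures that this infimum, taken in the reals, is a genuine
    minimum.\<close>
  have "(INF p\<in>dual_feasible b. dual_objective s p) = dual_objective s p"
    using p min by (intro cInf_eq_minimum) auto
  moreover have "is_arg_min (dual_objective s) (\<lambda>p. p \<in> dual_feasible b) p"
    using p min by (meson is_arg_min_linorder)
  ultimately show ?thesis
    using lagrangian_dual_eq_min[OF p min] by (simp del: split_paired_Ex) blast
qed

end
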